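(* Let $G$ be a simple graph with $n$ vertices, and let $S_{i,k}(G)$ and $M_2^{(p)}(G)$ be as defined in the context. Then for every natural number $p$, $$M_2^{(p)}(G)=\sum_{i=0}^{n-2} \sum_{k=i}^{n-2} i!\, k! \left\{ {p+1 \atop i+1}\right\} \left\{ {p+1 \atop k+1}\right\}S_{i,k}(G),$$ where $\left\{ {m \atop j}\right\}$ denotes the Stirling number of the second kind.
   Context: $G$ is a finite simple graph with $n$ vertices and edge set $E(G)$; $d_v$ denotes the degree of a vertex $v$. The general second Zagreb index is $M_2^{(p)}(G)=\sum_{\{u,v\}\in E(G)} (d_u d_v)^p$. For integers $0\le a\le b$, $$S_{a,b}(G)=\begin{cases} \displaystyle \sum_{\{u,v\} \in E(G)} \left( \binom{d_u-1}{a}\binom{d_v-1}{b}+ \binom{d_u-1}{b}\binom{d_v-1}{a} \right), & a < b,\\ \displaystyle \sum_{\{u,v\} \in E(G)} \binom{d_u-1}{a}\binom{d_v-1}{a}, & a = b, \end{cases}$$ with $\binom{x}{k}=0$ for $k>x$. *)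

theory Defs
  imports Main "HOL-Combinatorics.Stirling"
begin

locale fin_simple_graph =
  fixes V :: "'a set" and E :: "'a set set"
  assumes finite_verts: "finite V"
    and edges_two_verts: "e \<in> E \<Longrightarrow> e \<subseteq> V \<and> card e = 2"

definition degree :: "'a set set \<Rightarrow> 'a \<Rightarrow> nat" where
  "degree E v = card {e \<in> E. v \<in> e}"

text \<open>
  The term \<open>edge_sum E f\<close> renders \<open>\<Sum>\<close> over \<open>{u, v} \<in> E\<close> of \<open>f u v\<close>. It is meant for
  symmetric \<open>f\<close>, where \<open>f u v\<close> depends only on the unordered pair \<open>{u, v}\<close>.
\<close>

definition edge_val :: "('a \<Rightarrow> 'a \<Rightarrow> 'b) \<Rightarrow> 'a set \<Rightarrow> 'b" where
  "edge_val f e = (THE s. \<exists>u v. e = {u, v} \<and> s = f u v)"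

definition edge_sum :: "'a set set \<Rightarrow> ('a \<Rightarrow> 'a \<Rightarrow> 'b::comm_monoid_add) \<Rightarrow> 'b" where
  "edge_sum E f = (\<Sum>e\<in>E. edge_val f e)"

lemma edge_val_insert:
  assumes "f u v = f v u"
  shows "edge_val f {u, v} = f u v"
  unfolding edge_val_def
proof (rule the_equality)
  show "\<exists>u' v'. {u, v} = {u', v'} \<and> f u v = f u' v'"
    by blast
next
  fix s
  assume "\<exists>u' v'. {u, v} = {u', v'} \<and> s = f u' v'"
  then show "s = f u v"
    using assms by (auto simp: doubleton_eq_iff)
qed

definition general_second_Zagreb :: "nat \<Rightarrow> 'a set set \<Rightarrow> nat" where
  "general_second_Zagreb p E = edge_sum E (\<lambda>u v. (degree E u * degree E v) ^ p)"

text \<open>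
  Only used for \<open>a \<le> b\<close>. The truncated subtraction is harmless, as the endpoints of an edge
  of a finite graph have degree at least 1.
\<close>

definition S_index :: "nat \<Rightarrow> nat \<Rightarrow> 'a set set \<Rightarrow> nat" where
  "S_index a b E =
    (if a = b
     then edge_sum E (\<lambda>u v. ((degree E u - 1) choose a) * ((degree E v - 1) choose a))
     else edge_sum E (\<lambda>u v. ((degree E u - 1) choose a) * ((degree E v - 1) choose b)
                           + ((degree E u - 1) choose b) * ((degree E v - 1) choose a)))"

end

theory Submission
  imports Defs
begin

text \<open>
  The proof rests on the expansion \<open>d ^ p = (\<Sum>i. i! * Stirling (p+1) (i+1) * (d-1 choose i))\<close>
  for \<open>d \<ge> 1\<close>. Multiplying the expansions at the two endpoints of an edge and grouping the terms
  \<open>(i, k)\<close> and \<open>(k, i)\<close> gives the summand of \<open>S_index i k\<close>; the sums may be cut off at \<open>n - 2\<close>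
  because every degree is at most \<open>n - 1\<close>.
\<close>

text \<open>Induction on \<open>p\<close>: the recurrence for
  \<open>Stirling (p + 2) (i + 1)\<close> splits the sum in two; after an index shift in one half,
  the \<open>i\<close>-th terms carry the weights \<open>Suc i\<close> and \<open>m - i\<close>,
  which add up to \<open>Suc m\<close>.\<close>

lemma Suc_power_eq_sum_Stirling_choose:
  assumes "m < N"
  shows "Suc m ^ p = (\<Sum>i<N. fact i * Stirling (p + 1) (i + 1) * (m choose i))"
proof (induction p)
  case 0
  have "(\<Sum>i<N. fact i * Stirling (0 + 1) (i + 1) * (m choose i)) = (\<Sum>i<N. if i = 0 then 1 else 0)"
    by (rule sum.cong) (auto simp: gr0_conv_Suc)
  then show ?case
    using assms by simp
next
  case (Suc p)
  let ?s = "Stirling (p + 1)"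
  let ?g = "\<lambda>i. fact i * ?s i * (m choose i)"
  have choose_step: "fact (Suc i) * (m choose Suc i) = fact i * ((m - i) * (m choose i))" for i
  proof -
    have "Suc i * (m choose Suc i) = (m - i) * (m choose i)"
      by (simp only: binomial_absorption binomial_absorb_comp)
    then show ?thesis
      by (simp only: fact_Suc of_nat_id mult.assoc mult.left_commute[of "Suc i" "fact i"])
  qed
  \<comment> \<open>Both ends of the shift cost nothing: the added term at \<open>N\<close> vanishes
    because \<open>m < N\<close>, the dropped term at 0 because
    \<open>Stirling (p + 1) 0 = 0\<close>.\<close>
  have "(\<Sum>i<N. ?g i) = (\<Sum>i<Suc N. ?g i)"
    using assms by (simp add: binomial_eq_0)
  also have "\<dots> = (\<Sum>i<N. ?g (Suc i))"
    by (subst sum.lessThan_Suc_shift) simp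
  also have "\<dots> = (\<Sum>i<N. (m - i) * (fact i * ?s (i + 1) * (m choose i)))"
  proof (rule sum.cong)
    show "?g (Suc i) = (m - i) * (fact i * ?s (i + 1) * (m choose i))" for i
      using arg_cong[OF choose_step[of i], of "\<lambda>x. ?s (Suc i) * x"]
      by (simp add: ac_simps del: fact_Suc Stirling.simps)
  qed simp
  finally have shifted:
    "(\<Sum>i<N. ?g i) = (\<Sum>i<N. (m - i) * (fact i * ?s (i + 1) * (m choose i)))" .
  have "(\<Sum>i<N. fact i * Stirling (Suc p + 1) (i + 1) * (m choose i))
      = (\<Sum>i<N. Suc i * (fact i * ?s (i + 1) * (m choose i)) + ?g i)"
    by (rule sum.cong) (simp_all add: algebra_simps)
  also have "\<dots> = (\<Sum>i<N. Suc i * (fact i * ?s (i + 1) * (m choose i))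
                       + (m - i) * (fact i * ?s (i + 1) * (m choose i)))"
    by (simp only: sum.distrib shifted)
  also have "\<dots> = (\<Sum>i<N. Suc m * (fact i * ?s (i + 1) * (m choose i)))"
  proof (rule sum.cong)
    show "Suc i * (fact i * ?s (i + 1) * (m choose i)) + (m - i) * (fact i * ?s (i + 1) * (m choose i))
        = Suc m * (fact i * ?s (i + 1) * (m choose i))" for i
    proof (cases "i \<le> m")
      case True
      then have "Suc m = Suc i + (m - i)" by simp
      then show ?thesis by (simp only: add_mult_distrib)
    next
      \<comment> \<open>Truncated subtraction spoils the sum of the weights here, but the factor
        \<open>m choose i\<close> is 0.\<close>
      case False
      then show ?thesis by (simp add: binomial_eq_0)
    qed
  qed simp
  also have "\<dots> = Suc m ^ Suc p"
    by (simp only: sum_distrib_left[symmetric] Suc.IH[symmetric] power_Suc)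
  finally show ?case by simp
qed

text \<open>Folds the square of all products along its diagonal: \<open>(i, k)\<close> and
  \<open>(k, i)\<close> share a term, diagonal pairs count once.\<close>

lemma sum_mult_sum_eq_triangular:
  fixes x y :: "nat \<Rightarrow> 'b::comm_semiring_0"
  shows "(\<Sum>i<N. x i) * (\<Sum>i<N. y i) =
    (\<Sum>i<N. \<Sum>k = i..<N. if i = k then x i * y i else x i * y k + x k * y i)"
proof (induction N)
  case 0
  show ?case by simp
next
  case (Suc N)
  let ?t = "\<lambda>i k. if i = k then x i * y i else x i * y k + x k * y i"
  \<comment> \<open>Passing to \<open>Suc N\<close> adds the column \<open>k = N\<close> to every
    earlier row and a last row that is a single diagonal term.\<close>
  have "(\<Sum>i<Suc N. \<Sum>k = i..<Suc N. ?t i k)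
      = (\<Sum>i<N. (\<Sum>k = i..<N. ?t i k) + ?t i N) + x N * y N"
    by simp
  also have "(\<Sum>i<N. (\<Sum>k = i..<N. ?t i k) + ?t i N)
      = (\<Sum>i<N. (\<Sum>k = i..<N. ?t i k) + (x i * y N + x N * y i))"
    by (rule sum.cong) auto
  also have "\<dots> = (\<Sum>i<N. x i) * (\<Sum>i<N. y i) + ((\<Sum>i<N. x i) * y N + x N * (\<Sum>i<N. y i))"
    by (simp only: sum.distrib Suc.IH[symmetric] sum_distrib_left[symmetric] sum_distrib_right[symmetric])
  finally show ?case
    by (simp add: algebra_simps)
qed

context fin_simple_graph
begin

lemma finite_edges: "finite E"
  using finite_verts edges_two_verts by (auto intro: finite_subset[of E "Pow V"])

lemma degree_pos:
  assumes "e \<in> E" "v \<in> e"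
  shows "0 < degree E v"
  \<comment> \<open>Finiteness matters, since \<open>card\<close> of an infinite set is 0.\<close>
  using assms finite_edges by (auto simp: degree_def card_gt_0_iff)

text \<open>An edge at \<open>v\<close> is determined by its other endpoint, which lies in
  \<open>V - {v}\<close>.\<close>

lemma degree_less_card:
  assumes "v \<in> V"
  shows "degree E v < card V"
proof -
  have "{e \<in> E. v \<in> e} \<subseteq> (\<lambda>w. {v, w}) ` (V - {v})"
  proof
    fix e assume "e \<in> {e \<in> E. v \<in> e}"
    then have e: "v \<in> e" "e \<subseteq> V" "card e = 2"
      using edges_two_verts by auto
    then obtain a b where "e = {a, b}" "a \<noteq> b"
      by (auto simp: card_2_iff)
    with e show "e \<in> (\<lambda>w. {v, w}) ` (V - {v})"
      by (auto simp: insert_commute)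
  qed
  then have "degree E v \<le> card (V - {v})"
    unfolding degree_def using finite_verts by (intro surj_card_le) auto
  also have "\<dots> < card V"
    using assms finite_verts by (intro card_Diff1_less)
  finally show ?thesis .
qed

end

theorem theorem2:
  fixes V :: "'a set" and E :: "'a set set" and n p :: nat
  assumes "fin_simple_graph V E" and "card V = n"
  shows "general_second_Zagreb p E =
    (\<Sum>i = 0..<n - 1. \<Sum>k = i..<n - 1.
       fact i * fact k * Stirling (p + 1) (i + 1) * Stirling (p + 1) (k + 1) * S_index i k E)"
proof -
  interpret fin_simple_graph V E by fact
  let ?c = "\<lambda>i. fact i * Stirling (p + 1) (i + 1)"
  let ?b = "\<lambda>v i. (degree E v - 1) choose i"
  let ?f = "\<lambda>i k u v. if i = k then ?b u i * ?b v i else ?b u i * ?b v k + ?b u k * ?b v i"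
  \<comment> \<open>The case distinction on \<open>i = k\<close> moves from outside the edge sum
    into its summand.\<close>
  have S_index: "S_index i k E = (\<Sum>e\<in>E. edge_val (?f i k) e)" for i k
    by (simp add: S_index_def edge_sum_def)
  have edge: "edge_val (\<lambda>u v. (degree E u * degree E v) ^ p) e
      = (\<Sum>i<n - 1. \<Sum>k = i..<n - 1. ?c i * ?c k * edge_val (?f i k) e)" if "e \<in> E" for e
  proof -
    obtain u v where e: "e = {u, v}"
      using edges_two_verts[OF \<open>e \<in> E\<close>] by (auto simp: card_2_iff)
    have power: "degree E w ^ p = (\<Sum>i<n - 1. ?c i * ?b w i)" if "w \<in> e" for w
    proof -
      \<comment> \<open>Positivity gives \<open>degree E w = Suc (degree E w - 1)\<close>; both
        bounds together give \<open>degree E w - 1 < n - 1\<close>, the condition for the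
        cut-off.\<close>
      have "0 < degree E w" "degree E w < n"
        using degree_pos[OF \<open>e \<in> E\<close> that] degree_less_card[of w] edges_two_verts[OF \<open>e \<in> E\<close>]
          that assms(2) by auto
      then show ?thesis
        using Suc_power_eq_sum_Stirling_choose[of "degree E w - 1" "n - 1" p] by simp
    qed
    have "edge_val (\<lambda>u v. (degree E u * degree E v) ^ p) e = degree E u ^ p * degree E v ^ p"
      unfolding e by (subst edge_val_insert) (simp_all add: power_mult_distrib mult.commute)
    also have "\<dots> = (\<Sum>i<n - 1. ?c i * ?b u i) * (\<Sum>i<n - 1. ?c i * ?b v i)"
      using power e by simp
    also have "\<dots> = (\<Sum>i<n - 1. \<Sum>k = i..<n - 1. ?c i * ?c k * ?f i k u v)"
      unfolding sum_mult_sum_eq_triangular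
      by (intro sum.cong refl) (simp add: algebra_simps del: Stirling.simps)
    \<comment> \<open>\<open>?f i k\<close> is symmetric in \<open>u\<close> and \<open>v\<close>,
      so \<open>edge_val\<close> is well determined.\<close>
    also have "\<dots> = (\<Sum>i<n - 1. \<Sum>k = i..<n - 1. ?c i * ?c k * edge_val (?f i k) e)"
      unfolding e by (subst edge_val_insert) (auto simp: ac_simps)
    finally show ?thesis .
  qed
  have "general_second_Zagreb p E
      = (\<Sum>e\<in>E. \<Sum>i<n - 1. \<Sum>k = i..<n - 1. ?c i * ?c k * edge_val (?f i k) e)"
    unfolding general_second_Zagreb_def edge_sum_def by (intro sum.cong refl edge)
  \<comment> \<open>The range of \<open>k\<close> depends on \<open>i\<close> but not on
    \<open>e\<close>, so the edge sum moves inward by one swap per index.\<close>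
  also have "\<dots> = (\<Sum>i<n - 1. \<Sum>k = i..<n - 1. \<Sum>e\<in>E. ?c i * ?c k * edge_val (?f i k) e)"
    by (subst sum.swap) (intro sum.cong refl sum.swap)
  also have "\<dots> = (\<Sum>i = 0..<n - 1. \<Sum>k = i..<n - 1.
       fact i * fact k * Stirling (p + 1) (i + 1) * Stirling (p + 1) (k + 1) * S_index i k E)"
    unfolding S_index lessThan_atLeast0
    by (intro sum.cong refl) (simp only: sum_distrib_left[symmetric] ac_simps)
  finally show ?thesis .
qed

end
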